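(* Let $X$ be a real Banach space and let $A:X\rightrightarrows X^*$ be ultramaximally monotone. Then $A$ is of type (NA).
   Context: $X$ is a real Banach space with dual $X^*$ and bidual $X^{**}$; $X$ is identified with its canonical image in $X^{**}$, and $\langle\cdot,\cdot\rangle$ denotes the duality pairing. For a set-valued operator $A:X\rightrightarrows X^*$, $\operatorname{gra}A=\{(x,x^* )\in X\times X^*\mid x^*\in Ax\}$. $A$ is monotone if $\langle x-y,x^*-y^*\rangle\ge 0$ for all $(x,x^* ),(y,y^* )\in\operatorname{gra}A$. A monotone $A$ is ultramaximally monotone if it is maximally monotone with respect to $X^{**}\times X^*$: whenever $(x^{**},x^* )\in X^{**}\times X^*$ satisfies $\langle x^{**}-a,x^*-a^*\rangle\ge 0$ for all $(a,a^* )\in\operatorname{gra}A$, then $x^{**}\in X$ and $(x^{**},x^* )\in\operatorname{gra}A$. A monotone $A$ is of type (NA) ("negative alignment") if for every $(x,x^* )\in (X\times X^* )\setminus\operatorname{gra}A$ there exists $(a,a^* )\in\operatorname{gra}A$ such that $a\neq x$, $a^*\neq x^*$ and $\langle x-a,x^*-a^*\rangle=-\|x-a\|\cdot\|x^*-a^*\|$. *)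

theory Defs
  imports "HOL-Analysis.Analysis"
begin

type_synonym 'a dual = "'a \<Rightarrow>\<^sub>L real"
type_synonym 'a bidual = "'a dual \<Rightarrow>\<^sub>L real"

(* The canonical embedding of a normed space into its bidual. *)
definition canon :: "'a::real_normed_vector \<Rightarrow> 'a bidual" where
  "canon x = Blinfun (\<lambda>f. blinfun_apply f x)"

lemma canon_apply [simp]: "blinfun_apply (canon x) f = blinfun_apply f x"
  unfolding canon_def
  by (simp add: bounded_linear_Blinfun_apply blinfun.bounded_linear_left)

definition gra :: "('a \<Rightarrow> 'b set) \<Rightarrow> ('a \<times> 'b) set" where
  "gra A = {(x, y). y \<in> A x}"

definition monotone_op :: "('a::real_normed_vector \<Rightarrow> 'a dual set) \<Rightarrow> bool" where
  "monotone_op A \<longleftrightarrow>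
     (\<forall>(x, x') \<in> gra A. \<forall>(y, y') \<in> gra A. blinfun_apply (x' - y') (x - y) \<ge> 0)"

definition ultramaximally_monotone ::
    "('a::real_normed_vector \<Rightarrow> 'a dual set) \<Rightarrow> bool" where
  "ultramaximally_monotone A \<longleftrightarrow> monotone_op A \<and>
     (\<forall>x'' x'. (\<forall>(a, a') \<in> gra A. blinfun_apply (x'' - canon a) (x' - a') \<ge> 0)
        \<longrightarrow> (\<exists>x. x'' = canon x \<and> (x, x') \<in> gra A))"

definition type_NA :: "('a::real_normed_vector \<Rightarrow> 'a dual set) \<Rightarrow> bool" where
  "type_NA A \<longleftrightarrow> monotone_op A \<and>
     (\<forall>x x'. (x, x') \<notin> gra A \<longrightarrow>
        (\<exists>(a, a') \<in> gra A. a \<noteq> x \<and> a' \<noteq> x' \<and>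
           blinfun_apply (x' - a') (x - a) = - (norm (x - a) * norm (x' - a'))))"

end

theory Submission
  imports Defs
begin

text \<open>Translate so that the given point outside \<open>gra A\<close> is \<open>(0, 0)\<close>. The Fitzpatrick function \<open>F\<close> of
  \<open>A\<close> dominates the pairing on \<open>X \<times> X*\<close>, hence also \<open>-q\<close> with
  \<open>q (u, u') = \<parallel>u\<parallel>\<^sup>2 / 2 + \<parallel>u'\<parallel>\<^sup>2 / 2\<close>. An affine function separating \<open>-q\<close> from \<open>F\<close>
  is given by some \<open>(x', x'') \<in> X* \<times> X**\<close> and a constant \<open>c \<ge> \<parallel>x'\<parallel>\<^sup>2 / 2 + \<parallel>x''\<parallel>\<^sup>2 / 2\<close>.
  This bound on \<open>c\<close> makes \<open>(x'', x')\<close> monotonically related to \<open>gra A\<close>, so ultramaximality puts it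
  in \<open>gra A\<close>; then all the inequalities are equalities, that is, \<open>\<parallel>x'\<parallel> = \<parallel>x''\<parallel>\<close> and
  \<open>x'' x' = - \<parallel>x''\<parallel> \<parallel>x'\<parallel>\<close>. Equal norms rule out that just one of the two vanishes.\<close>

section \<open>Convex functions and their linear minorants\<close>

text \<open>Partial minimisation preserves convexity. \<open>mix\<close> expresses joint convexity
  without a linear structure on the index set, so the indices may be a chain of functions, the reals
  or a convex set. As infima need not be attained, indices within \<open>e\<close> of them are
  mixed.\<close>

lemma convex_on_INF:
  fixes \<phi> :: "'i \<Rightarrow> 'a::real_vector \<Rightarrow> real"
  assumes ne: "I \<noteq> {}"
    and bdd: "\<And>x. bdd_below ((\<lambda>i. \<phi> i x) ` I)"
    and mix: "\<And>i j x y t. i \<in> I \<Longrightarrow> j \<in> I \<Longrightarrow> 0 < t \<Longrightarrow> t < 1 \<Longrightarrow>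
      \<exists>m\<in>I. \<phi> m ((1 - t) *\<^sub>R x + t *\<^sub>R y) \<le> (1 - t) * \<phi> i x + t * \<phi> j y"
  shows "convex_on UNIV (\<lambda>x. INF i\<in>I. \<phi> i x)"
proof (rule convex_onI)
  fix t :: real and x y :: 'a
  assume t: "0 < t" "t < 1"
  let ?k = "\<lambda>x. INF i\<in>I. \<phi> i x"
  show "?k ((1 - t) *\<^sub>R x + t *\<^sub>R y) \<le> (1 - t) * ?k x + t * ?k y"
  proof (rule field_le_epsilon)
    fix e :: real
    assume e: "0 < e"
    have approx: "\<exists>i\<in>I. \<phi> i z < ?k z + e" for z
      using cINF_less_iff[OF ne bdd, of z "?k z + e"] e by simp
    obtain i j where ij: "i \<in> I" "\<phi> i x < ?k x + e" "j \<in> I" "\<phi> j y < ?k y + e"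
      using approx by meson
    obtain m where m: "m \<in> I"
      "\<phi> m ((1 - t) *\<^sub>R x + t *\<^sub>R y) \<le> (1 - t) * \<phi> i x + t * \<phi> j y"
      using mix[OF ij(1,3) t] by blast
    have "?k ((1 - t) *\<^sub>R x + t *\<^sub>R y) \<le> \<phi> m ((1 - t) *\<^sub>R x + t *\<^sub>R y)"
      by (rule cINF_lower[OF bdd m(1)])
    also have "\<dots> \<le> (1 - t) * \<phi> i x + t * \<phi> j y"
      by (rule m(2))
    also have "\<dots> \<le> (1 - t) * (?k x + e) + t * (?k y + e)"
      using ij t by (intro add_mono mult_left_mono) auto
    also have "\<dots> = (1 - t) * ?k x + t * ?k y + e"
      by (simp add: algebra_simps)
    finally show "?k ((1 - t) *\<^sub>R x + t *\<^sub>R y) \<le> (1 - t) * ?k x + t * ?k y + e" .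
  qed
qed simp

lemma convex_on_midpoint:
  fixes f :: "'a::real_vector \<Rightarrow> real"
  assumes "convex_on UNIV f"
  shows "2 * f ((1/2) *\<^sub>R (x + y)) \<le> f x + f y"
  using convex_onD[OF assms, of "1/2" x y] by (simp add: scaleR_right_distrib)

text \<open>One-dimensional Hahn-Banach: the origin is a convex combination of
  \<open>s *\<^sub>R y\<close> and \<open>- t *\<^sub>R y\<close>, so the quotients of
  \<open>f\<close> on the negative side lie below those on the positive side, and any number between
  them is a slope.\<close>

lemma convex_on_line_slope:
  fixes f :: "'a::real_vector \<Rightarrow> real"
  assumes f: "convex_on UNIV f" and f0: "0 \<le> f 0"
  obtains d where "\<And>t. t * d \<le> f (t *\<^sub>R y)"
proof -
  have cross: "- f (- t *\<^sub>R y) / t \<le> f (s *\<^sub>R y) / s" if "0 < s" "0 < t" for s t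
  proof -
    let ?u = "s / (s + t)"
    have u: "0 \<le> ?u" "?u \<le> 1" "1 - ?u = t / (s + t)"
      using that by (auto simp: field_simps)
    have "f 0 = f ((1 - ?u) *\<^sub>R (s *\<^sub>R y) + ?u *\<^sub>R (- t *\<^sub>R y))"
      unfolding u(3) by (simp add: algebra_simps)
    also have "\<dots> \<le> (1 - ?u) * f (s *\<^sub>R y) + ?u * f (- t *\<^sub>R y)"
      using u by (intro convex_onD[OF f]) auto
    finally have "0 \<le> t / (s + t) * f (s *\<^sub>R y) + ?u * f (- t *\<^sub>R y)"
      using f0 unfolding u(3) by simp
    also have "\<dots> = (t * f (s *\<^sub>R y) + s * f (- t *\<^sub>R y)) / (s + t)"
      by (simp add: add_divide_distrib)
    finally have "0 \<le> t * f (s *\<^sub>R y) + s * f (- t *\<^sub>R y)"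
      using that by (simp add: zero_le_divide_iff)
    then show ?thesis
      using that by (simp add: field_simps)
  qed
  define d where "d = (INF s\<in>{0<..}. f (s *\<^sub>R y) / s)"
  have bdd: "bdd_below ((\<lambda>s. f (s *\<^sub>R y) / s) ` {0<..})"
    using cross[of _ 1] by (intro bdd_belowI2[where m = "- f (- 1 *\<^sub>R y) / 1"]) simp
  have "t * d \<le> f (t *\<^sub>R y)" for t
  proof (cases t "0::real" rule: linorder_cases)
    case greater
    then have "d \<le> f (t *\<^sub>R y) / t"
      unfolding d_def by (intro cINF_lower[OF bdd]) auto
    with greater show ?thesis
      by (simp add: field_simps)
  next
    case less
    then have "- f (- (- t) *\<^sub>R y) / (- t) \<le> d"
      unfolding d_def by (intro cINF_greatest cross) auto
    with less show ?thesis
      by (simp add: field_simps)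
  qed (simp add: f0)
  with that show thesis .
qed

text \<open>Take a minimal convex function \<open>f\<close> below \<open>k\<close> with \<open>f 0 \<ge> 0\<close>. For every direction \<open>y\<close>
  and every slope \<open>d\<close> of \<open>f\<close> along \<open>y\<close>, the function \<open>INF t. f (x + t y) - t d\<close> is a competitor,
  so minimality makes \<open>f\<close> affine along \<open>y\<close>.\<close>

theorem convex_on_dominates_linear:
  fixes k :: "'a::real_vector \<Rightarrow> real"
  assumes k: "convex_on UNIV k" and k0: "0 \<le> k 0"
  obtains l where "linear l" "\<And>x. l x \<le> k x"
proof -
  define M where "M = {f. convex_on UNIV f \<and> 0 \<le> f 0 \<and> f \<le> k}"
  \<comment> \<open>The midpoint of \<open>x\<close> and \<open>- x\<close> is \<open>0\<close>. The
    bound does not depend on \<open>f\<close>, which keeps infima over chains finite.\<close>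
  have lower: "- k (- x) \<le> f x" if "f \<in> M" for f x
  proof -
    have "0 \<le> 2 * f ((1/2) *\<^sub>R (x + - x))"
      using that by (simp add: M_def)
    also have "\<dots> \<le> f x + f (- x)"
      using that by (intro convex_on_midpoint) (simp add: M_def)
    also have "f (- x) \<le> k (- x)"
      using that by (simp add: M_def le_fun_def)
    finally show ?thesis by simp
  qed
  have "\<exists>f\<in>M. \<forall>g\<in>M. g \<le> f \<longrightarrow> g = f"
  proof (rule predicate_Zorn)
    \<comment> \<open>The order is reversed: Zorn's lemma then yields a minimal element, and chains
      are bounded by their pointwise infimum.\<close>
    show "partial_order_on M (relation_of (\<lambda>f g. g \<le> f) M)"
      by (rule partial_order_on_relation_ofI) auto
  next
    fix C
    assume "C \<in> Chains (relation_of (\<lambda>f g. g \<le> f) M)"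
    then have CM: "C \<subseteq> M" and chain: "\<And>f g. f \<in> C \<Longrightarrow> g \<in> C \<Longrightarrow> f \<le> g \<or> g \<le> f"
      by (auto simp: Chains_def relation_of_def)
    show "\<exists>u\<in>M. \<forall>f\<in>C. u \<le> f"
    proof (cases "C = {}")
      case True
      have "k \<in> M"
        using k k0 by (simp add: M_def)
      with True show ?thesis by blast
    next
      case False
      define u where "u = (\<lambda>x. INF f\<in>C. f x)"
      have bdd: "bdd_below ((\<lambda>f. f x) ` C)" for x
        using lower CM by (intro bdd_belowI2[where m = "- k (- x)"]) auto
      have ule: "u \<le> f" if "f \<in> C" for f
        unfolding u_def le_fun_def using cINF_lower[OF bdd that] by blast
      have "convex_on UNIV u"
        unfolding u_def
      proof (rule convex_on_INF[OF False bdd])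
        fix f g x y and t :: real
        assume fg: "f \<in> C" "g \<in> C" and t: "0 < t" "t < 1"
        \<comment> \<open>The smaller of the two chain members serves at both points.\<close>
        obtain m where m: "m \<in> C" "m \<le> f" "m \<le> g"
          using chain[OF fg] fg by blast
        have "convex_on UNIV m"
          using m CM by (auto simp: M_def)
        then have "m ((1 - t) *\<^sub>R x + t *\<^sub>R y) \<le> (1 - t) * m x + t * m y"
          using t by (intro convex_onD) auto
        also have "\<dots> \<le> (1 - t) * f x + t * g y"
          using m t by (intro add_mono mult_left_mono) (auto simp: le_fun_def)
        finally show "\<exists>m\<in>C. m ((1 - t) *\<^sub>R x + t *\<^sub>R y) \<le> (1 - t) * f x + t * g y"
          using m by blast
      qed
      moreover have "0 \<le> u 0"
        unfolding u_def using CM by (intro cINF_greatest[OF False]) (auto simp: M_def)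
      moreover have "u \<le> k"
      proof -
        obtain f where "f \<in> C" using False by blast
        then have "u \<le> f" "f \<le> k" using ule CM by (auto simp: M_def)
        then show ?thesis by simp
      qed
      ultimately show ?thesis
        using ule by (auto simp: M_def)
    qed
  qed
  then obtain f where f: "f \<in> M" and min: "\<And>g. g \<in> M \<Longrightarrow> g \<le> f \<Longrightarrow> g = f"
    by blast
  have fc: "convex_on UNIV f" and f0: "0 \<le> f 0" and fk: "f x \<le> k x" for x
    using f by (auto simp: M_def le_fun_def)
  have affine: "\<exists>d. \<forall>t x. f (x + t *\<^sub>R y) = f x + t * d" for y
  proof -
    obtain d where d: "\<And>t. t * d \<le> f (t *\<^sub>R y)"
      using convex_on_line_slope[OF fc f0, where y = y] by blast
    define g where "g = (\<lambda>x. INF t\<in>UNIV. f (x + t *\<^sub>R y) - t * d)"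
    \<comment> \<open>The midpoint of \<open>x + t *\<^sub>R y\<close> and \<open>- x\<close> is
      \<open>(t/2) *\<^sub>R y\<close>, where \<open>f\<close> is at least
      \<open>(t/2) * d\<close>.\<close>
    have bdd: "bdd_below (range (\<lambda>t. f (x + t *\<^sub>R y) - t * d))" for x
    proof (rule bdd_belowI2[where m = "- f (- x)"])
      fix t
      have "t * d = 2 * ((t/2) * d)" by simp
      also have "\<dots> \<le> 2 * f ((t/2) *\<^sub>R y)"
        using d[of "t/2"] by linarith
      also have "\<dots> = 2 * f ((1/2) *\<^sub>R ((x + t *\<^sub>R y) + - x))"
        by simp
      also have "\<dots> \<le> f (x + t *\<^sub>R y) + f (- x)"
        by (rule convex_on_midpoint[OF fc])
      finally show "- f (- x) \<le> f (x + t *\<^sub>R y) - t * d" by simp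
    qed
    have gle: "g x \<le> f (x + t *\<^sub>R y) - t * d" for x t
      unfolding g_def by (rule cINF_lower[OF bdd]) simp
    have "convex_on UNIV g"
      unfolding g_def
    proof (rule convex_on_INF[OF _ bdd])
      fix s r x z and t :: real
      assume t: "0 < t" "t < 1"
      let ?m = "(1 - t) * s + t * r"
      have "f ((1 - t) *\<^sub>R x + t *\<^sub>R z + ?m *\<^sub>R y)
          = f ((1 - t) *\<^sub>R (x + s *\<^sub>R y) + t *\<^sub>R (z + r *\<^sub>R y))"
        by (simp add: algebra_simps)
      also have "\<dots> \<le> (1 - t) * f (x + s *\<^sub>R y) + t * f (z + r *\<^sub>R y)"
        using t by (intro convex_onD[OF fc]) auto
      finally have "f ((1 - t) *\<^sub>R x + t *\<^sub>R z + ?m *\<^sub>R y) - ?m * d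
          \<le> (1 - t) * (f (x + s *\<^sub>R y) - s * d) + t * (f (z + r *\<^sub>R y) - r * d)"
        by (simp add: algebra_simps)
      then show "\<exists>m\<in>UNIV. f ((1 - t) *\<^sub>R x + t *\<^sub>R z + m *\<^sub>R y) - m * d
          \<le> (1 - t) * (f (x + s *\<^sub>R y) - s * d) + t * (f (z + r *\<^sub>R y) - r * d)"
        by blast
    qed simp
    moreover have "0 \<le> g 0"
      unfolding g_def using d by (intro cINF_greatest) auto
    moreover have gf: "g \<le> f"
      using gle[of _ 0] by (auto simp: le_fun_def)
    moreover have "g \<le> k"
      using gf f by (auto simp: M_def)
    ultimately have "g = f"
      by (intro min) (auto simp: M_def)
    then have le: "f x \<le> f (x + t *\<^sub>R y) - t * d" for x t
      using gle by simp
    \<comment> \<open>Stepping back by \<open>- t\<close> from \<open>x + t *\<^sub>R y\<close>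
      gives the reverse inequality.\<close>
    have "f (x + t *\<^sub>R y) = f x + t * d" for x t
      using le[of x t] le[of "x + t *\<^sub>R y" "- t"] by simp
    then show ?thesis by blast
  qed
  \<comment> \<open>Subtracting \<open>f 0\<close> makes the affine \<open>f\<close> linear, and
    \<open>0 \<le> f 0\<close> keeps the result below \<open>k\<close>.\<close>
  define l where "l = (\<lambda>x. f x - f 0)"
  have add: "f (x + t *\<^sub>R y) = f x + t * l y" for x y t
  proof -
    obtain d where d: "\<And>t x. f (x + t *\<^sub>R y) = f x + t * d"
      using affine by blast
    have "l y = d"
      using d[of 0 1] by (simp add: l_def)
    then show ?thesis using d by simp
  qed
  have "linear l"
  proof (rule linearI)
    show "l (x + y) = l x + l y" for x y
      using add[of x 1 y] by (simp add: l_def)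
    show "l (t *\<^sub>R y) = t *\<^sub>R l y" for t y
      using add[of 0 t y] by (simp add: l_def)
  qed
  moreover have "l x \<le> k x" for x
    using fk[of x] f0 by (simp add: l_def)
  ultimately show thesis by (rule that)
qed

text \<open>Subgradient at \<open>0\<close> of the infimal convolution \<open>w \<mapsto> INF (z, r). r + q (z - w)\<close>.\<close>

theorem convex_sandwich:
  fixes C :: "('a::real_vector \<times> real) set" and q :: "'a \<Rightarrow> real"
  assumes C: "convex C" "C \<noteq> {}" and q: "convex_on UNIV q"
    and ge: "\<And>z r. (z, r) \<in> C \<Longrightarrow> - q z \<le> r"
  obtains l c where "linear l" "\<And>z r. (z, r) \<in> C \<Longrightarrow> l z + c \<le> r" "\<And>v. - q v \<le> l v + c"
proof -
  define \<phi> where "\<phi> = (\<lambda>(z, r) w. r + q (z - w))"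
  define k where "k = (\<lambda>w. INF p\<in>C. \<phi> p w)"
  \<comment> \<open>The shift \<open>w\<close> cancels in the midpoint of \<open>z + w\<close> and
    \<open>y - w\<close>, and convexity of \<open>C\<close> makes \<open>ge\<close> available there.
    With \<open>p\<close> fixed this bounds the infimum \<open>k w\<close> from below.\<close>
  have mid: "- \<phi> p (- w) \<le> \<phi> p' w" if pp': "p \<in> C" "p' \<in> C" for p p' w
  proof -
    obtain z r y s where p: "p = (z, r)" "p' = (y, s)"
      by (cases p, cases p')
    have "(1/2) *\<^sub>R p + (1/2) *\<^sub>R p' \<in> C"
      using C(1) pp' by (intro convexD) auto
    then have "((1/2) *\<^sub>R ((z + w) + (y - w)), (r + s) / 2) \<in> C"
      by (simp add: p algebra_simps add_divide_distrib)
    then have "0 \<le> r + s + 2 * q ((1/2) *\<^sub>R ((z + w) + (y - w)))"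
      using ge by fastforce
    also have "2 * q ((1/2) *\<^sub>R ((z + w) + (y - w))) \<le> q (z + w) + q (y - w)"
      by (rule convex_on_midpoint[OF q])
    finally show ?thesis
      by (simp add: \<phi>_def p)
  qed
  have bdd: "bdd_below ((\<lambda>p. \<phi> p w) ` C)" for w
  proof -
    obtain p where "p \<in> C" using C(2) by blast
    then show ?thesis
      using mid by (intro bdd_belowI2[where m = "- \<phi> p (- w)"]) auto
  qed
  have "convex_on UNIV k"
    unfolding k_def
  proof (rule convex_on_INF[OF C(2) bdd])
    fix p p' x y and t :: real
    assume pp': "p \<in> C" "p' \<in> C" and t: "0 < t" "t < 1"
    obtain z r u s where p: "p = (z, r)" "p' = (u, s)"
      by (cases p, cases p')
    have "(1 - t) *\<^sub>R p + t *\<^sub>R p' \<in> C"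
      using C(1) pp' t by (intro convexD) auto
    moreover have "\<phi> ((1 - t) *\<^sub>R p + t *\<^sub>R p') ((1 - t) *\<^sub>R x + t *\<^sub>R y)
        \<le> (1 - t) * \<phi> p x + t * \<phi> p' y"
    proof -
      have "q ((1 - t) *\<^sub>R z + t *\<^sub>R u - ((1 - t) *\<^sub>R x + t *\<^sub>R y))
          = q ((1 - t) *\<^sub>R (z - x) + t *\<^sub>R (u - y))"
        by (simp add: algebra_simps)
      also have "\<dots> \<le> (1 - t) * q (z - x) + t * q (u - y)"
        using t by (intro convex_onD[OF q]) auto
      finally show ?thesis
        by (simp add: \<phi>_def p algebra_simps)
    qed
    ultimately show "\<exists>m\<in>C. \<phi> m ((1 - t) *\<^sub>R x + t *\<^sub>R y) \<le> (1 - t) * \<phi> p x + t * \<phi> p' y"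
      by blast
  qed
  moreover have "0 \<le> k 0"
    unfolding k_def
  proof (rule cINF_greatest[OF C(2)])
    fix p assume "p \<in> C"
    then show "0 \<le> \<phi> p 0"
      using ge[of "fst p" "snd p"] by (cases p) (auto simp: \<phi>_def)
  qed
  ultimately obtain l where l: "linear l" and lk: "\<And>w. l w \<le> k w"
    by (rule convex_on_dominates_linear) blast
  \<comment> \<open>The shift \<open>w = z - v\<close> turns \<open>q (z - w)\<close> into
    \<open>q v\<close>.\<close>
  have sep: "l z - r \<le> l v + q v" if "(z, r) \<in> C" for z r v
  proof -
    have "l z - l v = l (z - v)"
      using l by (simp add: linear_diff)
    also have "\<dots> \<le> \<phi> (z, r) (z - v)"
      using lk[of "z - v"] cINF_lower[OF bdd that, of "z - v"] by (simp add: k_def)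
    finally show ?thesis
      by (simp add: \<phi>_def)
  qed
  \<comment> \<open>The largest constant for which \<open>l + c\<close> stays below
    \<open>C\<close>.\<close>
  define c where "c = - (SUP (z, r)\<in>C. l z - r)"
  have bdda: "bdd_above ((\<lambda>(z, r). l z - r) ` C)"
    using sep[of _ _ 0] by (intro bdd_aboveI2[where M = "l 0 + q 0"]) auto
  have "l z + c \<le> r" if "(z, r) \<in> C" for z r
    using cSUP_upper[OF that bdda] by (simp add: c_def)
  moreover have "- q v \<le> l v + c" for v
  proof -
    have "(SUP (z, r)\<in>C. l z - r) \<le> l v + q v"
      using sep by (intro cSUP_least[OF C(2)]) auto
    then show ?thesis by (simp add: c_def)
  qed
  ultimately show thesis
    using that l by blast
qed

section \<open>Norms of functionals and the canonical embedding\<close>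

text \<open>The lower bound needs a norming functional. A linear minorant \<open>l\<close> of
  \<open>norm (w + a) - norm a\<close> is one: the triangle inequality gives
  \<open>l w \<le> norm w\<close>, and \<open>w = - a\<close> gives
  \<open>norm a \<le> l a\<close>.\<close>

lemma norm_canon [simp]: "norm (canon a) = norm (a::'a::real_normed_vector)"
proof (rule antisym)
  show "norm (canon a) \<le> norm a"
  proof (rule norm_blinfun_bound)
    show "norm (blinfun_apply (canon a) f) \<le> norm a * norm f" for f
      using norm_blinfun[of f a] by (simp add: mult.commute)
  qed simp
  have "convex_on UNIV (\<lambda>w. norm (w + a) - norm a)"
  proof (rule convex_onI)
    fix t :: real and x y :: 'a
    assume t: "0 < t" "t < 1"
    have "norm ((1 - t) *\<^sub>R x + t *\<^sub>R y + a) = norm ((1 - t) *\<^sub>R (x + a) + t *\<^sub>R (y + a))"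
      by (simp add: algebra_simps)
    also have "\<dots> \<le> (1 - t) * norm (x + a) + t * norm (y + a)"
      using t by (intro norm_triangle_le) simp
    finally show "norm ((1 - t) *\<^sub>R x + t *\<^sub>R y + a) - norm a
        \<le> (1 - t) * (norm (x + a) - norm a) + t * (norm (y + a) - norm a)"
      by (simp add: algebra_simps)
  qed simp
  moreover have "0 \<le> norm (0 + a) - norm a"
    by simp
  ultimately obtain l where l: "linear l" and le: "\<And>w. l w \<le> norm (w + a) - norm a"
    by (rule convex_on_dominates_linear) blast
  have "l w \<le> norm w" for w
    using le[of w] norm_triangle_ineq[of w a] by linarith
  then have abs: "\<bar>l w\<bar> \<le> norm w" for w
    using linear_neg[OF l, of w] by (metis abs_le_iff norm_minus_cancel)
  then have bl: "bounded_linear l"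
    by (intro bounded_linear.intro bounded_linear_axioms.intro exI[of _ 1] l) simp
  have "norm a \<le> l a"
    using le[of "- a"] linear_neg[OF l, of a] by simp
  also have "\<dots> = blinfun_apply (canon a) (Blinfun l)"
    by (simp add: bounded_linear_Blinfun_apply bl)
  also have "\<dots> \<le> norm (canon a) * norm (Blinfun l)"
    using norm_blinfun[of "canon a" "Blinfun l"] by simp
  also have "\<dots> \<le> norm (canon a) * 1"
  proof (rule mult_left_mono)
    show "norm (Blinfun l) \<le> 1"
      using abs by (intro norm_blinfun_bound) (simp_all add: bounded_linear_Blinfun_apply bl)
  qed simp
  finally show "norm a \<le> norm (canon a)" by simp
qed

lemma convex_on_half_norm_sq:
  "convex_on UNIV (\<lambda>x::'a::real_normed_vector. (norm x)\<^sup>2 / 2)"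
proof (rule convex_onI)
  fix t :: real and x y :: 'a
  assume t: "0 < t" "t < 1"
  have "norm ((1 - t) *\<^sub>R x + t *\<^sub>R y) \<le> (1 - t) * norm x + t * norm y"
    using t by (intro norm_triangle_le) simp
  then have "(norm ((1 - t) *\<^sub>R x + t *\<^sub>R y))\<^sup>2 \<le> ((1 - t) * norm x + t * norm y)\<^sup>2"
    by (rule power_mono) simp
  also have "\<dots> = (1 - t) * (norm x)\<^sup>2 + t * (norm y)\<^sup>2 - t * (1 - t) * (norm x - norm y)\<^sup>2"
    by (simp add: power2_eq_square algebra_simps)
  also have "\<dots> \<le> (1 - t) * (norm x)\<^sup>2 + t * (norm y)\<^sup>2"
    using t by simp
  finally show "(norm ((1 - t) *\<^sub>R x + t *\<^sub>R y))\<^sup>2 / 2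
      \<le> (1 - t) * ((norm x)\<^sup>2 / 2) + t * ((norm y)\<^sup>2 / 2)"
    by (simp add: field_simps)
qed simp

text \<open>Symmetry of the unit ball makes the one-sided bound two-sided.\<close>

lemma bounded_linear_if_bounded_below:
  fixes f :: "'a::real_normed_vector \<Rightarrow> real"
  assumes f: "linear f" and below: "\<And>x. norm x \<le> 1 \<Longrightarrow> - B \<le> f x"
  shows "bounded_linear f"
proof -
  have "norm (f x) \<le> norm x * B" for x
  proof (cases "x = 0")
    case False
    let ?u = "(1 / norm x) *\<^sub>R x"
    have "f x = norm x * f ?u"
      using False by (simp add: linear_cmul[OF f])
    moreover have "\<bar>f ?u\<bar> \<le> B"
      using below[of ?u] below[of "- ?u"] False by (simp add: linear_neg[OF f] abs_le_iff)
    ultimately show ?thesis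
      by (simp add: abs_mult mult_left_mono)
  qed (simp add: linear_0[OF f])
  then show ?thesis
    by (intro bounded_linear.intro bounded_linear_axioms.intro exI[of _ B] f) auto
qed

text \<open>The supremum of \<open>f\<close> over the ball of radius \<open>norm f\<close> is
  \<open>(norm f)\<^sup>2\<close>. It need not be attained, so this replaces the choice of a
  maximiser when conjugating half the squared norm.\<close>

lemma norm_sq_blinfun_le:
  fixes f :: "'a::real_normed_vector \<Rightarrow>\<^sub>L real"
  assumes "\<And>x. norm x \<le> norm f \<Longrightarrow> blinfun_apply f x \<le> K"
  shows "(norm f)\<^sup>2 \<le> K"
proof (cases "f = 0")
  case True
  then show ?thesis
    using assms[of 0] by simp
next
  case False
  have K: "0 \<le> K" using assms[of 0] by simp
  have "norm f \<le> K / norm f"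
  proof (rule norm_blinfun_bound)
    show "0 \<le> K / norm f" using K by simp
    fix x
    show "norm (blinfun_apply f x) \<le> K / norm f * norm x"
    proof (cases "x = 0")
      case xne: False
      let ?s = "norm f / norm x"
      have "?s * \<bar>blinfun_apply f x\<bar> \<le> K"
        using assms[of "?s *\<^sub>R x"] assms[of "- (?s *\<^sub>R x)"] xne
        by (simp add: blinfun.scaleR_right blinfun.minus_right abs_if split: if_splits)
      then show ?thesis
        using xne False by (simp add: field_simps)
    qed simp
  qed
  then show ?thesis
    using False by (simp add: field_simps power2_eq_square)
qed

section \<open>The Fitzpatrick function and an antialigned point of the graph\<close>

text \<open>\<open>C\<close> is the epigraph of the Fitzpatrick function of \<open>G\<close>.\<close>

lemma ultramaximal_antialigned:
  fixes G :: "('a::real_normed_vector \<times> 'a dual) set"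
  assumes mono: "\<And>a a' b b'. (a, a') \<in> G \<Longrightarrow> (b, b') \<in> G \<Longrightarrow> 0 \<le> blinfun_apply (a' - b') (a - b)"
    and max: "\<And>x'' x'. (\<And>a a'. (a, a') \<in> G \<Longrightarrow> 0 \<le> blinfun_apply (x'' - canon a) (x' - a'))
      \<Longrightarrow> \<exists>x. x'' = canon x \<and> (x, x') \<in> G"
  obtains a a' where "(a, a') \<in> G" "norm a = norm a'"
    "blinfun_apply a' a = - (norm a * norm a')"
proof -
  define C where "C = {((u, u'), r). \<forall>(a, a')\<in>G.
    blinfun_apply a' u + blinfun_apply u' a - blinfun_apply a' a \<le> r}"
  define q where "q = (\<lambda>(u::'a, u'::'a dual). (norm u)\<^sup>2 / 2 + (norm u')\<^sup>2 / 2)"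
  \<comment> \<open>By monotonicity the Fitzpatrick function is at most the pairing on
    \<open>G\<close>.\<close>
  have CG: "((a, a'), blinfun_apply a' a) \<in> C" if "(a, a') \<in> G" for a a'
  proof -
    have "blinfun_apply b' a + blinfun_apply a' b - blinfun_apply b' b \<le> blinfun_apply a' a"
      if "(b, b') \<in> G" for b b'
      using mono[OF \<open>(a, a') \<in> G\<close> that] by (simp add: blinfun.bilinear_simps)
    then show ?thesis
      by (auto simp: C_def)
  qed
  \<comment> \<open>For empty \<open>G\<close> the premise of \<open>max\<close> is vacuous, yet its
    conclusion yields a point of \<open>G\<close>.\<close>
  have "G \<noteq> {}"
    using max by blast
  then have "C \<noteq> {}"
    using CG by fast
  have "convex C"
  proof (rule convexI)
    fix p p' and s t :: real
    assume pC: "p \<in> C" "p' \<in> C" and st: "0 \<le> s" "0 \<le> t" "s + t = 1"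
    obtain u u' r v v' r' where p: "p = ((u, u'), r)" "p' = ((v, v'), r')"
      by (metis surj_pair)
    have "blinfun_apply a' (s *\<^sub>R u + t *\<^sub>R v) + blinfun_apply (s *\<^sub>R u' + t *\<^sub>R v') a
        - blinfun_apply a' a \<le> s * r + t * r'" if "(a, a') \<in> G" for a a'
    proof -
      have 1: "blinfun_apply a' u + blinfun_apply u' a - blinfun_apply a' a \<le> r"
        and 2: "blinfun_apply a' v + blinfun_apply v' a - blinfun_apply a' a \<le> r'"
        using pC that by (auto simp: C_def p)
      have t: "t = 1 - s" using st by simp
      have "s * (blinfun_apply a' u + blinfun_apply u' a - blinfun_apply a' a)
          + t * (blinfun_apply a' v + blinfun_apply v' a - blinfun_apply a' a) \<le> s * r + t * r'"
        using 1 2 st by (intro add_mono mult_left_mono)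
      then show ?thesis
        by (simp add: t blinfun.bilinear_simps algebra_simps)
    qed
    then show "s *\<^sub>R p + t *\<^sub>R p' \<in> C"
      by (auto simp: C_def p)
  qed
  have "convex_on UNIV q"
  proof (rule convex_onI)
    fix t :: real and x y :: "'a \<times> 'a dual"
    assume t: "0 < t" "t < 1"
    have "q ((1 - t) *\<^sub>R x + t *\<^sub>R y) \<le>
        ((1 - t) * ((norm (fst x))\<^sup>2 / 2) + t * ((norm (fst y))\<^sup>2 / 2)) +
        ((1 - t) * ((norm (snd x))\<^sup>2 / 2) + t * ((norm (snd y))\<^sup>2 / 2))"
      unfolding q_def case_prod_beta fst_add snd_add fst_scaleR snd_scaleR
      using t by (intro add_mono convex_onD[OF convex_on_half_norm_sq]) auto
    also have "\<dots> = (1 - t) * q x + t * q y"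
      by (simp add: q_def case_prod_beta distrib_left)
    finally show "q ((1 - t) *\<^sub>R x + t *\<^sub>R y) \<le> (1 - t) * q x + t * q y" .
  qed simp
  \<comment> \<open>Otherwise \<open>(canon u, u')\<close> is strictly monotonically related to all
    of \<open>G\<close>; by \<open>max\<close> it comes from a point of \<open>G\<close>, and
    strictness fails at that point.\<close>
  have Cpair: "blinfun_apply u' u \<le> r" if "((u, u'), r) \<in> C" for u u' r
  proof (rule ccontr)
    assume r: "\<not> blinfun_apply u' u \<le> r"
    have pos: "0 < blinfun_apply (canon u - canon a) (u' - a')" if "(a, a') \<in> G" for a a'
    proof -
      have "blinfun_apply a' u + blinfun_apply u' a - blinfun_apply a' a \<le> r"
        using \<open>((u, u'), r) \<in> C\<close> that by (auto simp: C_def)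
      with r show ?thesis
        by (simp add: blinfun.bilinear_simps)
    qed
    then obtain a where a: "canon u = canon a" "(a, u') \<in> G"
      using max[of "canon u" u'] by (metis less_imp_le)
    show False
      using pos[OF a(2)] a(1) by simp
  qed
  have "- q z \<le> r" if "(z, r) \<in> C" for z r
  proof -
    obtain u u' where z: "z = (u, u')" by (cases z)
    have "- (norm u' * norm u) \<le> blinfun_apply u' u"
      using norm_blinfun[of u' u] by (simp add: abs_le_iff)
    moreover have "norm u' * norm u \<le> q z"
      using sum_squares_bound[of "norm u'" "norm u"] by (simp add: q_def z field_simps)
    ultimately show ?thesis
      using Cpair that by (fastforce simp: z)
  qed
  then obtain l c where l: "linear l" and lC: "\<And>z r. (z, r) \<in> C \<Longrightarrow> l z + c \<le> r"
    and lq: "\<And>v. - q v \<le> l v + c"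
    using convex_sandwich[OF \<open>convex C\<close> \<open>C \<noteq> {}\<close> \<open>convex_on UNIV q\<close>] by blast
  have l1: "linear (\<lambda>u. l (u, 0))" and l2: "linear (\<lambda>u'. l (0, u'))"
    using linear_add[OF l, of "(_, 0)" "(_, 0)"] linear_add[OF l, of "(0, _)" "(0, _)"]
      linear_cmul[OF l, of _ "(_, 0)"] linear_cmul[OF l, of _ "(0, _)"]
    by (auto intro!: linearI)
  have sq: "(norm x)\<^sup>2 / 2 \<le> 1" if "norm x \<le> 1" for x :: "'c::real_normed_vector"
    using power_mono[OF that, of 2] by simp
  \<comment> \<open>On the unit ball of each factor \<open>q\<close> is at most \<open>1\<close>, so
    \<open>- q \<le> l + c\<close> bounds \<open>l\<close> from below.\<close>
  have "bounded_linear (\<lambda>u. l (u, 0))" "bounded_linear (\<lambda>u'. l (0, u'))"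
  proof -
    have "- (c + 1) \<le> l (u, 0)" if "norm u \<le> 1" for u
      using lq[of "(u, 0)"] sq[OF that] by (simp add: q_def)
    then show "bounded_linear (\<lambda>u. l (u, 0))"
      by (rule bounded_linear_if_bounded_below[OF l1])
    have "- (c + 1) \<le> l (0, u')" if "norm u' \<le> 1" for u'
      using lq[of "(0, u')"] sq[OF that] by (simp add: q_def)
    then show "bounded_linear (\<lambda>u'. l (0, u'))"
      by (rule bounded_linear_if_bounded_below[OF l2])
  qed
  then obtain x' x'' where x': "\<And>u. blinfun_apply x' u = l (u, 0)"
    and x'': "\<And>u'. blinfun_apply x'' u' = l (0, u')"
    by (metis bounded_linear_Blinfun_apply)
  have lsum: "l (u, u') = blinfun_apply x' u + blinfun_apply x'' u'" for u u'
    using linear_add[OF l, of "(u, 0)" "(0, u')"] by (simp add: x' x'')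
  \<comment> \<open>The sign change makes \<open>c\<close> an upper bound for the conjugate of
    \<open>q\<close> at \<open>(x', x'')\<close>.\<close>
  have conj: "blinfun_apply x' u + blinfun_apply x'' u' \<le> c + (norm u)\<^sup>2 / 2 + (norm u')\<^sup>2 / 2" for u u'
    using lq[of "(- u, - u')"] by (simp add: lsum q_def blinfun.minus_right)
  \<comment> \<open>The left side is that conjugate; the supremum is taken over \<open>u\<close>
    first, then over \<open>u'\<close>.\<close>
  have c: "(norm x')\<^sup>2 / 2 + (norm x'')\<^sup>2 / 2 \<le> c"
  proof -
    have "blinfun_apply x'' u' \<le> c + (norm x'')\<^sup>2 / 2 - (norm x')\<^sup>2 / 2"
      if u': "norm u' \<le> norm x''" for u'
    proof -
      have "(norm x')\<^sup>2 \<le> c + (norm x')\<^sup>2 / 2 + (norm x'')\<^sup>2 / 2 - blinfun_apply x'' u'"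
      proof (rule norm_sq_blinfun_le)
        fix u :: 'a assume u: "norm u \<le> norm x'"
        show "blinfun_apply x' u \<le> c + (norm x')\<^sup>2 / 2 + (norm x'')\<^sup>2 / 2 - blinfun_apply x'' u'"
          using conj[of u u'] power_mono[OF u norm_ge_zero, of 2] power_mono[OF u' norm_ge_zero, of 2]
            by linarith
      qed
      then show ?thesis by simp
    qed
    then have "(norm x'')\<^sup>2 \<le> c + (norm x'')\<^sup>2 / 2 - (norm x')\<^sup>2 / 2"
      by (rule norm_sq_blinfun_le)
    then show ?thesis by simp
  qed
  have lower: "- (norm x'' * norm x') \<le> blinfun_apply x'' x'"
    using norm_blinfun[of x'' x'] by (simp add: abs_le_iff)
  \<comment> \<open>The exact defect is kept because it later forces the two norms to agree.\<close>
  have am: "(norm x')\<^sup>2 / 2 + (norm x'')\<^sup>2 / 2 = norm x'' * norm x' + (norm x' - norm x'')\<^sup>2 / 2"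
    by (simp add: power2_eq_square field_simps)
  \<comment> \<open>Expanding the right side reduces this to \<open>lC\<close> at the point of
    \<open>C\<close> above \<open>(a, a')\<close>; the left side is free of \<open>a\<close> and
    \<open>a'\<close>.\<close>
  have G: "blinfun_apply x'' x' + c \<le> blinfun_apply (x'' - canon a) (x' - a')"
    if "(a, a') \<in> G" for a a'
    using lC[OF CG[OF that]] by (simp add: lsum blinfun.bilinear_simps)
  have "0 \<le> blinfun_apply (x'' - canon a) (x' - a')" if "(a, a') \<in> G" for a a'
    using G[OF that] lower c am zero_le_power2[of "norm x' - norm x''"] by linarith
  then obtain a where a: "x'' = canon a" "(a, x') \<in> G"
    using max by blast
  \<comment> \<open>At the point itself the right side of \<open>G\<close> is zero, whereas
    \<open>lower\<close>, \<open>c\<close> and \<open>am\<close> make the left side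
    nonnegative.\<close>
  have le0: "blinfun_apply x'' x' + c \<le> 0"
    using G[OF a(2)] a(1) by simp
  then have "(norm x' - norm x'')\<^sup>2 \<le> 0"
    using lower c am by linarith
  then have eq: "norm x' = norm x''" by simp
  then have "blinfun_apply x'' x' = - (norm x'' * norm x')"
    using le0 lower c am by simp
  then show thesis
    using that[OF a(2)] eq by (simp add: a(1))
qed

section \<open>Translation to an arbitrary point outside the graph\<close>

theorem theorem3p12:
  fixes A :: "'a::banach \<Rightarrow> 'a dual set"
  assumes "ultramaximally_monotone A"
  shows "type_NA A"
proof -
  have mono: "monotone_op A"
    and max: "\<And>x'' x'. (\<And>a a'. (a, a') \<in> gra A \<Longrightarrow> 0 \<le> blinfun_apply (x'' - canon a) (x' - a'))
      \<Longrightarrow> \<exists>x. x'' = canon x \<and> (x, x') \<in> gra A"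
    using assms unfolding ultramaximally_monotone_def by blast+
  have "\<exists>(a, a')\<in>gra A. a \<noteq> x \<and> a' \<noteq> x' \<and>
      blinfun_apply (x' - a') (x - a) = - (norm (x - a) * norm (x' - a'))"
    if "(x, x') \<notin> gra A" for x x'
  proof -
    define G where "G = {(a, a'). (a + x, a' + x') \<in> gra A}"
    obtain a a' where a: "(a, a') \<in> G" "norm a = norm a'"
      "blinfun_apply a' a = - (norm a * norm a')"
    proof (rule ultramaximal_antialigned)
      show "0 \<le> blinfun_apply (a' - b') (a - b)" if "(a, a') \<in> G" "(b, b') \<in> G" for a a' b b'
        using mono that by (fastforce simp: G_def monotone_op_def)
    next
      fix y'' y'
      assume y: "\<And>a a'. (a, a') \<in> G \<Longrightarrow> 0 \<le> blinfun_apply (y'' - canon a) (y' - a')"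
      have canon_diff: "canon (b - x) = canon b - canon x" for b
        by (rule blinfun_eqI) (simp add: blinfun.bilinear_simps)
      \<comment> \<open>Translation by \<open>x\<close> becomes translation by
        \<open>canon x\<close> in the bidual, so \<open>max\<close> for \<open>gra A\<close> carries
        over to \<open>G\<close>.\<close>
      have "0 \<le> blinfun_apply ((y'' + canon x) - canon b) ((y' + x') - b')"
        if "(b, b') \<in> gra A" for b b'
        using y[of "b - x" "b' - x'"] that by (simp add: G_def canon_diff algebra_simps)
      then obtain b where b: "y'' + canon x = canon b" "(b, y' + x') \<in> gra A"
        using max by blast
      have "y'' = canon (b - x)"
        using b(1) by (simp add: canon_diff algebra_simps)
      with b(2) show "\<exists>a. y'' = canon a \<and> (a, y') \<in> G"
        by (auto simp: G_def intro!: exI[of _ "b - x"])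
    qed
    \<comment> \<open>If one vanished, so would the other, and \<open>(x, x')\<close> would lie in
      \<open>gra A\<close>.\<close>
    have "a \<noteq> 0" "a' \<noteq> 0"
      using a that by (auto simp: G_def)
    moreover have "blinfun_apply (x' - (a' + x')) (x - (a + x))
        = - (norm (x - (a + x)) * norm (x' - (a' + x')))"
      using a(3) by (simp add: blinfun.bilinear_simps)
    ultimately show ?thesis
      using a(1) by (intro bexI[of _ "(a + x, a' + x')"]) (auto simp: G_def)
  qed
  with mono show ?thesis
    unfolding type_NA_def by blast
qed

end
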